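(* Let $\mu$ be a sigma-finite measure on $\mathbb{R}$, let $f:\mathbb{R}\to\mathbb{R}$ be measurable, and consider the stochastic evolution equation $$dU=(p\,\mathrm{Id}+T_f)U\,dt+dW$$ on $L^2(\mathbb{R},\mu)$, where $T_f$ is the multiplication operator by $f$ with domain $D(T_f)\subset L^2(\mathbb{R},\mu)$ and $W$ is a cylindrical Wiener process. Assume that $f$ is continuous in a neighborhood of the points at which it attains its essential supremum. Then $$\lim_{p\to -\mathrm{esssup}(f)^-}\Vert V_\infty\Vert_{B(L^2)}=+\infty .$$
   Context: $T_f$ is defined by $(T_fu)(x):=f(x)u(x)$ with $D(T_f)=\{u\in L^2(\mathbb{R},\mu)\mid fu\in L^2(\mathbb{R},\mu)\}$; it is a (possibly unbounded) self-adjoint operator whose spectrum is the essential range of $f$. The essential supremum $\mathrm{esssup}(f)$ is taken with respect to $\mu$ and equals the supremum $M$ of the essential range of $f$; it is assumed to be finite, so that $-M$ is the value of the real parameter $p$ at which the spectrum of $p\,\mathrm{Id}+T_f$ reaches the imaginary axis. The limit is taken over $p<-M$, $p\to -M$. The cylindrical Wiener process is the generalized Wiener process with covariance operator $Q=\mathrm{Id}$. $V_\infty$ is the asymptotic covariance operator of the stochastic convolution $\int_0^t e^{(t-s)(p\,\mathrm{Id}+T_f)}\,dW_s$, i.e. $V_\infty=\int_0^\infty e^{2\tau(p\,\mathrm{Id}+T_f)}\,d\tau$. $\Vert\cdot\Vert_{B(L^2)}$ denotes the operator norm on linear operators induced by the norm of $L^2(\mathbb{R},\mu)$. *)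

theory Defs
  imports "HOL-Probability.Probability"
begin

section \<open>The Hilbert space of square-integrable functions and its operators\<close>

text \<open>
  Elements of the real Hilbert space $L^2(\mu)$ are handled through representatives: functions
  that agree almost everywhere are the same element, so equality in $L^2(\mu)$ is written
  with \<open>AE\<close>. An operator is a map on representatives.
\<close>

definition L2 :: "real measure \<Rightarrow> (real \<Rightarrow> real) set" where
  "L2 \<mu> = {u \<in> borel_measurable \<mu>. integrable \<mu> (\<lambda>x. (u x)\<^sup>2)}"

definition l2_inner :: "real measure \<Rightarrow> (real \<Rightarrow> real) \<Rightarrow> (real \<Rightarrow> real) \<Rightarrow> real" where
  "l2_inner \<mu> u v = (LINT x|\<mu>. u x * v x)"

definition l2_norm :: "real measure \<Rightarrow> (real \<Rightarrow> real) \<Rightarrow> real" where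
  "l2_norm \<mu> u = sqrt (l2_inner \<mu> u u)"

text \<open>
  Linearity together with the norm bound forces \<open>B u\<close> and \<open>B v\<close> to agree almost everywhere
  whenever \<open>u\<close> and \<open>v\<close> do, so the map descends to equivalence classes.
\<close>

definition bounded_op :: "real measure \<Rightarrow> ((real \<Rightarrow> real) \<Rightarrow> (real \<Rightarrow> real)) \<Rightarrow> bool" where
  "bounded_op \<mu> B \<longleftrightarrow>
     (\<forall>u\<in>L2 \<mu>. B u \<in> L2 \<mu>) \<and>
     (\<forall>u\<in>L2 \<mu>. \<forall>v\<in>L2 \<mu>. \<forall>a b. AE x in \<mu>. B (\<lambda>y. a * u y + b * v y) x = a * B u x + b * B v x) \<and>
     (\<exists>C. \<forall>u\<in>L2 \<mu>. l2_norm \<mu> (B u) \<le> C * l2_norm \<mu> u)"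

text \<open>The operator norm is extended-real valued, so that the supremum is never a default value.\<close>

definition op_norm :: "real measure \<Rightarrow> ((real \<Rightarrow> real) \<Rightarrow> (real \<Rightarrow> real)) \<Rightarrow> ereal" where
  "op_norm \<mu> B = (SUP u \<in> {u \<in> L2 \<mu>. l2_norm \<mu> u \<le> 1}. ereal (l2_norm \<mu> (B u)))"

definition adjoint_pair ::
  "real measure \<Rightarrow> ((real \<Rightarrow> real) \<Rightarrow> (real \<Rightarrow> real)) \<Rightarrow> ((real \<Rightarrow> real) \<Rightarrow> (real \<Rightarrow> real)) \<Rightarrow> bool" where
  "adjoint_pair \<mu> B B' \<longleftrightarrow> bounded_op \<mu> B \<and> bounded_op \<mu> B' \<and>
     (\<forall>u\<in>L2 \<mu>. \<forall>v\<in>L2 \<mu>. l2_inner \<mu> (B u) v = l2_inner \<mu> u (B' v))"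

definition mult_op :: "(real \<Rightarrow> real) \<Rightarrow> (real \<Rightarrow> real) \<Rightarrow> (real \<Rightarrow> real)" where
  "mult_op f u = (\<lambda>x. f x * u x)"

definition mult_dom :: "real measure \<Rightarrow> (real \<Rightarrow> real) \<Rightarrow> (real \<Rightarrow> real) set" where
  "mult_dom \<mu> f = {u \<in> L2 \<mu>. mult_op f u \<in> L2 \<mu>}"

definition shift_op ::
  "real \<Rightarrow> ((real \<Rightarrow> real) \<Rightarrow> (real \<Rightarrow> real)) \<Rightarrow> (real \<Rightarrow> real) \<Rightarrow> (real \<Rightarrow> real)" where
  "shift_op p A u = (\<lambda>x. p * u x + A u x)"

section \<open>Strongly continuous semigroups\<close>

definition c0_semigroup ::
  "real measure \<Rightarrow> (real \<Rightarrow> (real \<Rightarrow> real) \<Rightarrow> (real \<Rightarrow> real)) \<Rightarrow> bool" where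
  "c0_semigroup \<mu> S \<longleftrightarrow>
     (\<forall>t\<ge>0. bounded_op \<mu> (S t)) \<and>
     (\<forall>u\<in>L2 \<mu>. AE x in \<mu>. S 0 u x = u x) \<and>
     (\<forall>s\<ge>0. \<forall>t\<ge>0. \<forall>u\<in>L2 \<mu>. AE x in \<mu>. S (s + t) u x = S s (S t u) x) \<and>
     (\<forall>u\<in>L2 \<mu>. ((\<lambda>t. l2_norm \<mu> (\<lambda>x. S t u x - u x)) \<longlongrightarrow> 0) (at_right 0))"

definition right_derivative_at_0 ::
  "real measure \<Rightarrow> (real \<Rightarrow> (real \<Rightarrow> real) \<Rightarrow> (real \<Rightarrow> real)) \<Rightarrow> (real \<Rightarrow> real) \<Rightarrow> (real \<Rightarrow> real) \<Rightarrow> bool"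
  where
  "right_derivative_at_0 \<mu> S u v \<longleftrightarrow>
     ((\<lambda>t. l2_norm \<mu> (\<lambda>x. (S t u x - u x) / t - v x)) \<longlongrightarrow> 0) (at_right 0)"

text \<open>
  \<open>generates_semigroup \<mu> D A S\<close> says that the (possibly unbounded) operator \<open>A\<close> with domain
  exactly \<open>D\<close> is the infinitesimal generator of \<open>S\<close>, i.e. that \<open>S t\<close> is $e^{tA}$. This
  determines every \<open>S t u\<close> almost everywhere.
\<close>

definition generates_semigroup ::
  "real measure \<Rightarrow> (real \<Rightarrow> real) set \<Rightarrow> ((real \<Rightarrow> real) \<Rightarrow> (real \<Rightarrow> real))
    \<Rightarrow> (real \<Rightarrow> (real \<Rightarrow> real) \<Rightarrow> (real \<Rightarrow> real)) \<Rightarrow> bool" where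
  "generates_semigroup \<mu> D A S \<longleftrightarrow> c0_semigroup \<mu> S \<and>
     D = {u \<in> L2 \<mu>. \<exists>v\<in>L2 \<mu>. right_derivative_at_0 \<mu> S u v} \<and>
     (\<forall>u\<in>D. A u \<in> L2 \<mu> \<and> right_derivative_at_0 \<mu> S u (A u))"

section \<open>Cylindrical Wiener processes and stochastic convolutions\<close>

text \<open>The point mass at $0$ counts as a centred Gaussian law.\<close>

definition centred_gaussian :: "'w measure \<Rightarrow> ('w \<Rightarrow> real) \<Rightarrow> bool" where
  "centred_gaussian P X \<longleftrightarrow> X \<in> borel_measurable P \<and>
     ((AE \<omega> in P. X \<omega> = 0) \<or> (\<exists>\<sigma>>0. distributed P lborel X (normal_density 0 \<sigma>)))"

text \<open>
  \<open>W t h\<close> is the real random variable usually written $\langle W_t, h\rangle$, for $t \ge 0$ and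
  $h \in L^2(\mu)$; for \<open>Q = Id\<close> the process \<open>W t\<close> itself need not take values in $L^2(\mu)$.
  Every finite linear combination of the \<open>W t h\<close> being Gaussian says that the family is jointly
  Gaussian; with the covariance
  $E[\langle W_s,g\rangle\langle W_t,h\rangle] = \min(s,t)\langle Qg,h\rangle$ this makes
  $(\langle W_t,h_1\rangle,\dots,\langle W_t,h_n\rangle)_{t\ge0}$ an $n$-dimensional Wiener process
  with covariance matrix $(\langle Qh_i,h_j\rangle)_{ij}$, and makes \<open>W t h\<close> almost surely linear
  in \<open>h\<close>.
\<close>

definition generalized_wiener ::
  "'w measure \<Rightarrow> real measure \<Rightarrow> ((real \<Rightarrow> real) \<Rightarrow> (real \<Rightarrow> real))
    \<Rightarrow> (real \<Rightarrow> (real \<Rightarrow> real) \<Rightarrow> 'w \<Rightarrow> real) \<Rightarrow> bool" where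
  "generalized_wiener P \<mu> Q W \<longleftrightarrow> prob_space P \<and>
     (\<forall>(n::nat) c t h. (\<forall>i<n. 0 \<le> t i \<and> h i \<in> L2 \<mu>) \<longrightarrow>
        centred_gaussian P (\<lambda>\<omega>. \<Sum>i<n. c i * W (t i) (h i) \<omega>)) \<and>
     (\<forall>s\<ge>0. \<forall>t\<ge>0. \<forall>g\<in>L2 \<mu>. \<forall>h\<in>L2 \<mu>.
        prob_space.expectation P (\<lambda>\<omega>. W s g \<omega> * W t h \<omega>) = min s t * l2_inner \<mu> (Q g) h) \<and>
     (\<forall>h\<in>L2 \<mu>. AE \<omega> in P. continuous_on {0..} (\<lambda>t. W t h \<omega>))"

definition cylindrical_wiener ::
  "'w measure \<Rightarrow> real measure \<Rightarrow> (real \<Rightarrow> (real \<Rightarrow> real) \<Rightarrow> 'w \<Rightarrow> real) \<Rightarrow> bool" where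
  "cylindrical_wiener P \<mu> W \<longleftrightarrow> generalized_wiener P \<mu> (\<lambda>u. u) W"

text \<open>
  The Wiener integral $I = \int_0^t \langle \varphi(s), dW_s\rangle$ of a deterministic
  $\varphi : [0,t] \to L^2(\mu)$, as the mean-square limit of its left-endpoint Riemann sums. These
  converge, by the It\^o isometry, whenever $\varphi$ is continuous; this is the only case in which
  the definition is used.
\<close>

definition wiener_integral ::
  "'w measure \<Rightarrow> (real \<Rightarrow> (real \<Rightarrow> real) \<Rightarrow> 'w \<Rightarrow> real) \<Rightarrow> real \<Rightarrow> (real \<Rightarrow> (real \<Rightarrow> real))
    \<Rightarrow> ('w \<Rightarrow> real) \<Rightarrow> bool" where
  "wiener_integral P W t \<phi> I \<longleftrightarrow> I \<in> borel_measurable P \<and> integrable P (\<lambda>\<omega>. (I \<omega>)\<^sup>2) \<and>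
     (\<lambda>n. prob_space.expectation P (\<lambda>\<omega>. (I \<omega> -
        (\<Sum>i<n. W (real (Suc i) * t / real n) (\<phi> (real i * t / real n)) \<omega>
               - W (real i * t / real n) (\<phi> (real i * t / real n)) \<omega>))\<^sup>2)) \<longlonglongrightarrow> 0"

text \<open>
  The stochastic convolution $Z_t = \int_0^t S(t-s)\,dW_s$, which is the mild solution of
  $dU = AU\,dt + dW$, $U(0) = 0$, when \<open>A\<close> generates \<open>S\<close>. Like \<open>W\<close>, it is a
  cylindrical process:
  $\langle Z_t,h\rangle = \int_0^t \langle S(t-s)^*h, dW_s\rangle$. It is not assumed to take values
  in $L^2(\mu)$.
\<close>

definition stochastic_convolution ::
  "'w measure \<Rightarrow> real measure \<Rightarrow> (real \<Rightarrow> (real \<Rightarrow> real) \<Rightarrow> 'w \<Rightarrow> real)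
    \<Rightarrow> (real \<Rightarrow> (real \<Rightarrow> real) \<Rightarrow> (real \<Rightarrow> real)) \<Rightarrow> (real \<Rightarrow> (real \<Rightarrow> real) \<Rightarrow> 'w \<Rightarrow> real) \<Rightarrow> bool" where
  "stochastic_convolution P \<mu> W S Z \<longleftrightarrow>
     (\<exists>S'. (\<forall>t\<ge>0. adjoint_pair \<mu> (S t) (S' t)) \<and>
           (\<forall>t\<ge>0. \<forall>h\<in>L2 \<mu>. wiener_integral P W t (\<lambda>s. S' (t - s) h) (Z t h)))"

definition covariance :: "'w measure \<Rightarrow> ('w \<Rightarrow> real) \<Rightarrow> ('w \<Rightarrow> real) \<Rightarrow> real" where
  "covariance P X Y = prob_space.expectation P
     (\<lambda>\<omega>. (X \<omega> - prob_space.expectation P X) * (Y \<omega> - prob_space.expectation P Y))"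

text \<open>
  The covariance operator $V_t$ of $Z_t$ is given by
  $\langle V_t g,h\rangle = \mathrm{Cov}(\langle Z_t,g\rangle,\langle Z_t,h\rangle)$, and $V_\infty$ is
  its limit as $t \to \infty$. For the stochastic convolution of a self-adjoint semigroup $e^{tA}$
  with a cylindrical Wiener process, the It\^o isometry gives
  $\langle V_t g,h\rangle = \int_0^t \langle e^{2\tau A}g,h\rangle\,d\tau$, that is,
  $V_\infty = \int_0^\infty e^{2\tau A}\,d\tau$.
\<close>

definition asymptotic_covariance_op ::
  "'w measure \<Rightarrow> real measure \<Rightarrow> (real \<Rightarrow> (real \<Rightarrow> real) \<Rightarrow> 'w \<Rightarrow> real)
    \<Rightarrow> ((real \<Rightarrow> real) \<Rightarrow> (real \<Rightarrow> real)) \<Rightarrow> bool" where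
  "asymptotic_covariance_op P \<mu> Z V \<longleftrightarrow> bounded_op \<mu> V \<and>
     (\<forall>g\<in>L2 \<mu>. \<forall>h\<in>L2 \<mu>.
        ((\<lambda>t. covariance P (Z t g) (Z t h)) \<longlongrightarrow> l2_inner \<mu> (V g) h) at_top)"

end

theory Submission
  imports Defs
begin

text \<open>
  Write $A = p + T_f$, $e^{tA}$ for the semigroup \<open>S p t\<close>, and $b = -M - p > 0$ for the distance
  of $p$ from the threshold. The claim follows from the quantitative bound $\|V_\infty\| \ge 1/(8b)$.

  Since $M$ is the top of the essential range of $f$, there is a unit vector $u$ supported where
  $f$ lies within $b$ of $M$ (\<open>approximate_eigenfunction\<close>). It lies in the domain of $A$, and
  $\|Au\| \le a$ with $a = 2b$: the vector $u$ is almost invariant under $e^{tA}$ for times up to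
  order $1/a$, so noise in the direction $u$ accumulates over a time of that order.

  The variance of $\langle Z_t, u\rangle$ is, by the It\^o isometry, the limit $Q_t$ of the
  Riemann sums of $\int_0^t \|(e^{sA})^* u\|^2\,ds$ (\<open>stochastic_convolution_variance\<close>). For
  a lower bound, let $y(s) = \|(e^{sA})^* u\|$
  and $\varphi(s) = \langle e^{sA}u, u\rangle = \langle u, (e^{sA})^* u\rangle \le y(s)$. Then
  $\varphi(0) = 1$, and $\varphi' = \langle Au, (e^{sA})^* u\rangle$ gives
  $|\varphi'(s)| \le a\,y(s)$, whence for $s \le t$
  \[ y(s) \ge \varphi(s) \ge 1 - a \int_0^t y \ge 1 - a \sqrt{t\,Q_t}. \]
  Thus $y$ can only become small by having been large, and either way $Q_t$ is large: taking the
  root mean square in $s$ yields $\sqrt{Q_t/t} \ge 1 - a\sqrt{t\,Q_t}$, which for $t = 1/a$ reads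
  $Q_{1/a} \ge 1/(4a)$ (\<open>adjoint_orbit_integral_bound\<close>). All of this is carried out on the
  Riemann sums themselves, with difference quotients in place of $\varphi'$, because the
  definition of a semigroup gives continuity and derivatives only from the right, where a step
  function would also have derivative $0$.

  Finally $Q_t \le Q_{2t}$, so $Q_{1/a}$ is at most the limit
  $\langle V_\infty u, u\rangle \le \|V_\infty\|$ (\<open>asymptotic_covariance_op_norm_ge\<close>).
\<close>

section \<open>Square-integrable functions\<close>

text \<open>
  The same notion over an arbitrary measure space serves both for elements of $L^2(\mu)$ and for
  random variables with finite variance.
\<close>

definition square_integrable :: "'a measure \<Rightarrow> ('a \<Rightarrow> real) \<Rightarrow> bool" where
  "square_integrable M u \<longleftrightarrow> u \<in> borel_measurable M \<and> integrable M (\<lambda>x. (u x)\<^sup>2)"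

lemma L2_iff: "u \<in> L2 \<mu> \<longleftrightarrow> square_integrable \<mu> u"
  by (simp add: L2_def square_integrable_def)

lemma square_integrable_mult:
  assumes "square_integrable M u" "square_integrable M v"
  shows "integrable M (\<lambda>x. u x * v x)"
proof -
  have [measurable]: "u \<in> borel_measurable M" "v \<in> borel_measurable M"
    using assms by (auto simp: square_integrable_def)
  have "integrable M (\<lambda>x. (u x)\<^sup>2 + (v x)\<^sup>2)"
    using assms by (auto simp: square_integrable_def)
  then show ?thesis
  proof (rule Bochner_Integration.integrable_bound)
    have "\<bar>a * b\<bar> \<le> a\<^sup>2 + b\<^sup>2" for a b :: real
    proof -
      have "0 \<le> (\<bar>a\<bar> - \<bar>b\<bar>)\<^sup>2" "0 \<le> \<bar>a * b\<bar>" by simp_all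
      then show ?thesis unfolding power2_diff abs_mult power2_abs by linarith
    qed
    then show "AE x in M. norm (u x * v x) \<le> norm ((u x)\<^sup>2 + (v x)\<^sup>2)"
      by (simp add: order_trans[OF _ abs_ge_self])
  qed simp
qed

lemma square_integrable_cmult:
  "square_integrable M u \<Longrightarrow> square_integrable M (\<lambda>x. a * u x)"
  by (auto simp: square_integrable_def power_mult_distrib)

lemma square_integrable_add:
  assumes "square_integrable M u" "square_integrable M v"
  shows "square_integrable M (\<lambda>x. u x + v x)"
  using assms square_integrable_mult[OF assms]
  by (auto simp: square_integrable_def power2_sum mult.assoc)

lemma square_integrable_diff:
  assumes "square_integrable M u" "square_integrable M v"
  shows "square_integrable M (\<lambda>x. u x - v x)"
  using square_integrable_add[OF assms(1) square_integrable_cmult[OF assms(2), of "-1"]] by simp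

lemma square_integrable_sum:
  "(\<And>i. i \<in> I \<Longrightarrow> square_integrable M (u i)) \<Longrightarrow> square_integrable M (\<lambda>x. \<Sum>i\<in>I. u i x)"
proof (induction I rule: infinite_finite_induct)
  case (insert i I)
  then show ?case by (simp add: square_integrable_add)
qed (simp_all add: square_integrable_def)

text \<open>
  The quadratic form $\int (su + rv)^2$ in $(s, r)$ is nonnegative, so its discriminant is not
  positive.
\<close>

lemma Cauchy_Schwarz_integral:
  assumes u: "square_integrable M u" and v: "square_integrable M v"
  shows "\<bar>LINT x|M. u x * v x\<bar> \<le> sqrt (LINT x|M. (u x)\<^sup>2) * sqrt (LINT x|M. (v x)\<^sup>2)"
proof -
  let ?A = "LINT x|M. (u x)\<^sup>2" and ?B = "LINT x|M. (v x)\<^sup>2" and ?C = "LINT x|M. u x * v x"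
  have q: "0 \<le> s\<^sup>2 * ?A + 2 * s * r * ?C + r\<^sup>2 * ?B" for s r :: real
  proof -
    have "0 \<le> (LINT x|M. (s * u x + r * v x)\<^sup>2)" by simp
    also have "\<dots> = (LINT x|M. s\<^sup>2 * (u x)\<^sup>2 + 2 * s * r * (u x * v x) + r\<^sup>2 * (v x)\<^sup>2)"
      by (intro Bochner_Integration.integral_cong) (auto simp: power2_eq_square algebra_simps)
    also have "\<dots> = s\<^sup>2 * ?A + 2 * s * r * ?C + r\<^sup>2 * ?B"
      using u v square_integrable_mult[OF u v] by (simp add: square_integrable_def)
    finally show ?thesis .
  qed
  \<comment> \<open>The minimising choice \<open>s = ?B\<close>, \<open>r = - ?C\<close> is informative only if \<open>?B > 0\<close>; if \<open>?B = 0\<close>,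
    the form is affine in \<open>r\<close> and bounded below, which forces \<open>?C = 0\<close>.\<close>
  have "?C\<^sup>2 \<le> ?A * ?B"
  proof (cases "?B = 0")
    case True
    have "0 \<le> ?A" by simp
    have "?C = 0"
    proof (rule ccontr)
      assume "?C \<noteq> 0"
      have "0 \<le> ?A + 2 * (- (?A + 1) / (2 * ?C)) * ?C"
        using q[of 1 "- (?A + 1) / (2 * ?C)"] True by simp
      with \<open>?C \<noteq> 0\<close> show False by (simp add: field_simps)
    qed
    with True show ?thesis by simp
  next
    case False
    moreover have "0 \<le> ?B" by simp
    ultimately have B: "0 < ?B" by linarith
    have "0 \<le> ?B * (?A * ?B - ?C\<^sup>2)"
      using q[of ?B "- ?C"] by (simp add: power2_eq_square algebra_simps)
    with B have "0 \<le> ?A * ?B - ?C\<^sup>2"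
      by (simp add: zero_le_mult_iff)
    then show ?thesis by simp
  qed
  then have "sqrt (?C\<^sup>2) \<le> sqrt (?A * ?B)" by (rule real_sqrt_le_mono)
  then show ?thesis by (simp only: real_sqrt_mult real_sqrt_abs)
qed

lemma l2_norm_eq: "l2_norm \<mu> u = sqrt (LINT x|\<mu>. (u x)\<^sup>2)"
  by (simp add: l2_norm_def l2_inner_def power2_eq_square)

lemma l2_norm_nonneg: "0 \<le> l2_norm \<mu> u"
  by (simp add: l2_norm_eq)

lemma l2_inner_self: "l2_inner \<mu> u u = (l2_norm \<mu> u)\<^sup>2"
  by (simp add: l2_norm_eq l2_inner_def power2_eq_square)

lemma l2_Cauchy_Schwarz:
  assumes "u \<in> L2 \<mu>" "v \<in> L2 \<mu>"
  shows "\<bar>l2_inner \<mu> u v\<bar> \<le> l2_norm \<mu> u * l2_norm \<mu> v"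
  using Cauchy_Schwarz_integral assms by (simp add: l2_norm_eq l2_inner_def L2_iff)

lemma l2_inner_commute: "l2_inner \<mu> u v = l2_inner \<mu> v u"
  by (simp add: l2_inner_def mult.commute)

lemma l2_inner_cong_AE:
  assumes "u \<in> L2 \<mu>" "u' \<in> L2 \<mu>" "v \<in> L2 \<mu>" "AE x in \<mu>. u x = u' x"
  shows "l2_inner \<mu> u v = l2_inner \<mu> u' v"
  unfolding l2_inner_def using assms
  by (intro integral_cong_AE) (auto simp: L2_def)

lemma l2_inner_add:
  assumes "u \<in> L2 \<mu>" "v \<in> L2 \<mu>" "w \<in> L2 \<mu>"
  shows "l2_inner \<mu> (\<lambda>x. a * u x + b * v x) w = a * l2_inner \<mu> u w + b * l2_inner \<mu> v w"
  using assms square_integrable_mult[of \<mu> u w] square_integrable_mult[of \<mu> v w]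
  by (simp add: l2_inner_def L2_iff distrib_right mult.assoc)

section \<open>The second moment of a Wiener integral\<close>

lemma centred_gaussian_square_integrable:
  assumes "prob_space P" "centred_gaussian P X"
  shows "square_integrable P X" "prob_space.expectation P X = 0"
proof -
  interpret prob_space P by fact
  have X: "X \<in> borel_measurable P" using assms by (simp add: centred_gaussian_def)
  consider "AE \<omega> in P. X \<omega> = 0" |
    \<sigma> where "\<sigma> > 0" "distributed P lborel X (normal_density 0 \<sigma>)"
    using assms(2) by (auto simp: centred_gaussian_def)
  then have "integrable P (\<lambda>\<omega>. (X \<omega>)\<^sup>2) \<and> expectation X = 0"
  proof cases
    case 1
    have "integrable P (\<lambda>\<omega>. (X \<omega>)\<^sup>2) \<longleftrightarrow> integrable P (\<lambda>\<omega>. 0::real)"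
      using 1 X by (intro integrable_cong_AE) auto
    moreover have "expectation X = expectation (\<lambda>\<omega>. 0::real)"
      using 1 X by (intro integral_cong_AE) auto
    ultimately show ?thesis by simp
  next
    case 2
    have "integrable lborel (\<lambda>x. normal_density 0 \<sigma> x * x\<^sup>2)"
      using integrable_normal_moment[OF 2(1), of 0 2] by simp
    then have "integrable P (\<lambda>\<omega>. (X \<omega>)\<^sup>2)"
      by (subst (asm) distributed_integrable[OF 2(2)]) auto
    then show ?thesis using normal_distributed_expectation[OF 2] by simp
  qed
  then show "square_integrable P X" "expectation X = 0"
    using X by (auto simp: square_integrable_def)
qed

text \<open>
  The covariance formula for $W$ alone would not give integrability, since the expectation of a
  non-integrable variable is $0$ by convention; the Gaussian laws do.
\<close>

lemma generalized_wiener_square_integrable: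
  assumes "generalized_wiener P \<mu> Q W" "0 \<le> t" "h \<in> L2 \<mu>"
  shows "square_integrable P (W t h)" "prob_space.expectation P (W t h) = 0"
proof -
  have P: "prob_space P" using assms(1) by (simp add: generalized_wiener_def)
  have "centred_gaussian P (\<lambda>\<omega>. \<Sum>i<(1::nat). 1 * W t h \<omega>)"
    using assms(1)[unfolded generalized_wiener_def, THEN conjunct2, THEN conjunct1,
        rule_format, of 1 "\<lambda>_. t" "\<lambda>_. h" "\<lambda>_. 1"] assms(2,3)
    by blast
  then have "centred_gaussian P (W t h)" by simp
  then show "square_integrable P (W t h)" "prob_space.expectation P (W t h) = 0"
    using centred_gaussian_square_integrable[OF P] by auto
qed

text \<open>
  The increments over the disjoint intervals $[ih,(i+1)h]$ are uncorrelated, because the second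
  difference of $\min$ over two different intervals vanishes; over a single interval it is $h$.
\<close>

lemma Ito_isometry_step:
  fixes \<phi> :: "nat \<Rightarrow> real \<Rightarrow> real" and h :: real
  assumes W: "cylindrical_wiener P \<mu> W" and h: "0 \<le> h"
    and \<phi>: "\<And>i. i < n \<Longrightarrow> \<phi> i \<in> L2 \<mu>"
  defines "R \<equiv> \<lambda>\<omega>. \<Sum>i<n. W (real (Suc i) * h) (\<phi> i) \<omega> - W (real i * h) (\<phi> i) \<omega>"
  shows "square_integrable P R" "prob_space.expectation P R = 0"
    "prob_space.expectation P (\<lambda>\<omega>. (R \<omega>)\<^sup>2) = h * (\<Sum>i<n. (l2_norm \<mu> (\<phi> i))\<^sup>2)"
proof -
  have gw: "generalized_wiener P \<mu> (\<lambda>u. u) W"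
    using W by (simp add: cylindrical_wiener_def)
  then interpret prob_space P by (simp add: generalized_wiener_def)
  have cov: "expectation (\<lambda>\<omega>. W s g \<omega> * W t k \<omega>) = min s t * l2_inner \<mu> g k"
    if "0 \<le> s" "0 \<le> t" "g \<in> L2 \<mu>" "k \<in> L2 \<mu>" for s t g k
    using gw that unfolding generalized_wiener_def by blast
  define X where "X i \<omega> = W (real (Suc i) * h) (\<phi> i) \<omega> - W (real i * h) (\<phi> i) \<omega>" for i \<omega>
  have R: "R = (\<lambda>\<omega>. \<Sum>i<n. X i \<omega>)" by (simp add: R_def X_def)
  have W2: "square_integrable P (W (real k * h) (\<phi> i))"
    and W0: "expectation (W (real k * h) (\<phi> i)) = 0" if "i < n" for i k
    using generalized_wiener_square_integrable[OF gw, of "real k * h" "\<phi> i"] h \<phi>[OF that] by auto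
  have X2: "square_integrable P (X i)" if "i < n" for i
    unfolding X_def using W2[OF that, of "Suc i"] W2[OF that, of i]
    by (intro square_integrable_diff)
  have X1: "integrable P (X i)" if "i < n" for i
    using X2[OF that] square_integrable_imp_integrable by (auto simp: square_integrable_def)
  have X0: "expectation (X i) = 0" if "i < n" for i
  proof -
    have "integrable P (W (real k * h) (\<phi> i))" for k
      using W2[OF that, of k] square_integrable_imp_integrable by (auto simp: square_integrable_def)
    then show ?thesis unfolding X_def using W0[OF that]
      by (subst Bochner_Integration.integral_diff) (auto simp del: of_nat_Suc)
  qed
  show "square_integrable P R" unfolding R by (intro square_integrable_sum X2) auto
  show "expectation R = 0" unfolding R using X0 X1
    by (subst Bochner_Integration.integral_sum) auto
  have XX: "expectation (\<lambda>\<omega>. X i \<omega> * X j \<omega>) = (if i = j then h * (l2_norm \<mu> (\<phi> i))\<^sup>2 else 0)"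
    if ij: "i < n" "j < n" for i j
  proof -
    let ?w = "\<lambda>k i. W (real k * h) (\<phi> i)"
    have I: "integrable P (\<lambda>\<omega>. ?w k i \<omega> * ?w l j \<omega>)" for k l
      using square_integrable_mult[OF W2[OF ij(1)] W2[OF ij(2)]] .
    have c: "expectation (\<lambda>\<omega>. ?w k i \<omega> * ?w l j \<omega>)
        = min (real k * h) (real l * h) * l2_inner \<mu> (\<phi> i) (\<phi> j)" for k l
      using cov[of "real k * h" "real l * h" "\<phi> i" "\<phi> j"] h \<phi> ij by simp
    have "expectation (\<lambda>\<omega>. X i \<omega> * X j \<omega>) = expectation (\<lambda>\<omega>. ?w (Suc i) i \<omega> * ?w (Suc j) j \<omega>
        - ?w (Suc i) i \<omega> * ?w j j \<omega> - ?w i i \<omega> * ?w (Suc j) j \<omega> + ?w i i \<omega> * ?w j j \<omega>)"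
      by (intro Bochner_Integration.integral_cong) (simp_all add: X_def algebra_simps)
    also have "\<dots> = (min (real (Suc i) * h) (real (Suc j) * h) - min (real (Suc i) * h) (real j * h)
        - min (real i * h) (real (Suc j) * h) + min (real i * h) (real j * h))
        * l2_inner \<mu> (\<phi> i) (\<phi> j)"
      unfolding Bochner_Integration.integral_add[OF Bochner_Integration.integrable_diff[OF
          Bochner_Integration.integrable_diff[OF I I] I] I]
        Bochner_Integration.integral_diff[OF Bochner_Integration.integrable_diff[OF I I] I]
        Bochner_Integration.integral_diff[OF I I] c
      by (simp add: algebra_simps)
    also have "\<dots> = (if i = j then h * (l2_norm \<mu> (\<phi> i))\<^sup>2 else 0)"
    proof -
      have mn: "min (real k * h) (real l * h) = real (min k l) * h" for k l
        using h by (cases k l rule: linorder_le_cases)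
          (simp_all add: min_absorb1 min_absorb2 mult_right_mono)
      consider "i = j" | "i < j" | "j < i" by linarith
      then show ?thesis unfolding mn
        by cases (simp_all add: min_absorb1 min_absorb2 l2_inner_self algebra_simps)
    qed
    finally show ?thesis .
  qed
  have "expectation (\<lambda>\<omega>. (R \<omega>)\<^sup>2) = expectation (\<lambda>\<omega>. \<Sum>i<n. \<Sum>j<n. X i \<omega> * X j \<omega>)"
    by (simp add: R power2_eq_square sum_product)
  also have "\<dots> = (\<Sum>i<n. \<Sum>j<n. expectation (\<lambda>\<omega>. X i \<omega> * X j \<omega>))"
    by (subst Bochner_Integration.integral_sum)
      (auto intro!: sum.cong Bochner_Integration.integral_sum Bochner_Integration.integrable_sum
        square_integrable_mult X2)
  also have "\<dots> = (\<Sum>i<n. \<Sum>j<n. if i = j then h * (l2_norm \<mu> (\<phi> i))\<^sup>2 else 0)"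
    by (intro sum.cong refl XX) auto
  also have "\<dots> = (\<Sum>i<n. h * (l2_norm \<mu> (\<phi> i))\<^sup>2)" by simp
  finally show "expectation (\<lambda>\<omega>. (R \<omega>)\<^sup>2) = h * (\<Sum>i<n. (l2_norm \<mu> (\<phi> i))\<^sup>2)"
    by (simp add: sum_distrib_left)
qed

lemma mean_square_limit_moments:
  assumes "prob_space P" and I: "square_integrable P I" and R: "\<And>n. square_integrable P (R n)"
    and lim: "(\<lambda>n. prob_space.expectation P (\<lambda>\<omega>. (I \<omega> - R n \<omega>)\<^sup>2)) \<longlonglongrightarrow> 0"
  shows "(\<lambda>n. prob_space.expectation P (R n)) \<longlonglongrightarrow> prob_space.expectation P I"
    and "(\<lambda>n. prob_space.expectation P (\<lambda>\<omega>. (R n \<omega>)\<^sup>2)) \<longlonglongrightarrow>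
           prob_space.expectation P (\<lambda>\<omega>. (I \<omega>)\<^sup>2)"
proof -
  interpret prob_space P by fact
  define e where "e n = expectation (\<lambda>\<omega>. (I \<omega> - R n \<omega>)\<^sup>2)" for n
  have e: "e \<longlonglongrightarrow> 0" unfolding e_def by (rule lim)
  have D: "square_integrable P (\<lambda>\<omega>. I \<omega> - R n \<omega>)" for n
    by (intro square_integrable_diff I R)
  \<comment> \<open>Testing against a fixed \<open>Y\<close> covers both claims: \<open>Y = 1\<close> for the means, \<open>Y = I\<close> for the squares.\<close>
  have weak: "(\<lambda>n. expectation (\<lambda>\<omega>. Y \<omega> * (I \<omega> - R n \<omega>))) \<longlonglongrightarrow> 0"
    if Y: "square_integrable P Y" for Y
  proof (rule Lim_null_comparison)
    show "\<forall>\<^sub>F n in sequentially. norm (expectation (\<lambda>\<omega>. Y \<omega> * (I \<omega> - R n \<omega>)))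
        \<le> sqrt (expectation (\<lambda>\<omega>. (Y \<omega>)\<^sup>2)) * sqrt (e n)"
      using Cauchy_Schwarz_integral[OF Y D] by (simp add: e_def)
    show "(\<lambda>n. sqrt (expectation (\<lambda>\<omega>. (Y \<omega>)\<^sup>2)) * sqrt (e n)) \<longlonglongrightarrow> 0"
      using tendsto_mult[OF tendsto_const tendsto_real_sqrt[OF e]] by simp
  qed
  have int1: "integrable P I" "integrable P (R n)" for n
    using I R square_integrable_imp_integrable by (auto simp: square_integrable_def)
  have "(\<lambda>n. expectation (\<lambda>\<omega>. 1 * (I \<omega> - R n \<omega>))) \<longlonglongrightarrow> 0"
    by (rule weak) (simp add: square_integrable_def)
  then have "(\<lambda>n. expectation I - expectation (R n)) \<longlonglongrightarrow> 0"
    using int1 by simp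
  from tendsto_diff[OF tendsto_const[of "expectation I"] this]
  show "(\<lambda>n. expectation (R n)) \<longlonglongrightarrow> expectation I" by simp
  have "expectation (\<lambda>\<omega>. (R n \<omega>)\<^sup>2)
      = expectation (\<lambda>\<omega>. (I \<omega>)\<^sup>2) + e n - 2 * expectation (\<lambda>\<omega>. I \<omega> * (I \<omega> - R n \<omega>))" for n
  proof -
    have "expectation (\<lambda>\<omega>. (R n \<omega>)\<^sup>2)
        = expectation (\<lambda>\<omega>. (I \<omega>)\<^sup>2 + (I \<omega> - R n \<omega>)\<^sup>2 - 2 * (I \<omega> * (I \<omega> - R n \<omega>)))"
      by (intro Bochner_Integration.integral_cong) (auto simp: power2_eq_square algebra_simps)
    also have "\<dots> = expectation (\<lambda>\<omega>. (I \<omega>)\<^sup>2) + e n - 2 * expectation (\<lambda>\<omega>. I \<omega> * (I \<omega> - R n \<omega>))"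
      using I D[of n] square_integrable_mult[OF I D[of n]]
      by (simp add: square_integrable_def e_def)
    finally show ?thesis .
  qed
  moreover have "(\<lambda>n. expectation (\<lambda>\<omega>. (I \<omega>)\<^sup>2) + e n - 2 * expectation (\<lambda>\<omega>. I \<omega> * (I \<omega> - R n \<omega>)))
      \<longlonglongrightarrow> expectation (\<lambda>\<omega>. (I \<omega>)\<^sup>2) + 0 - 2 * 0"
    by (intro tendsto_intros e weak I)
  ultimately show "(\<lambda>n. expectation (\<lambda>\<omega>. (R n \<omega>)\<^sup>2)) \<longlonglongrightarrow> expectation (\<lambda>\<omega>. (I \<omega>)\<^sup>2)"
    by simp
qed

text \<open>
  The left-endpoint sums of $s \mapsto S'(t-s)u$ become, after reversing the order of summation,
  right-endpoint sums of $s \mapsto S'(s)u$; this is why the index $k+1$ appears.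
\<close>

lemma stochastic_convolution_variance:
  assumes W: "cylindrical_wiener P \<mu> W"
    and I: "wiener_integral P W t (\<lambda>s. S' (t - s) u) I"
    and S': "\<And>s. 0 \<le> s \<Longrightarrow> S' s u \<in> L2 \<mu>" and t: "0 \<le> t"
  shows "(\<lambda>n. t / real n * (\<Sum>k<n. (l2_norm \<mu> (S' (real (Suc k) * (t / real n)) u))\<^sup>2))
           \<longlonglongrightarrow> covariance P I I"
proof -
  interpret prob_space P
    using W by (simp add: cylindrical_wiener_def generalized_wiener_def)
  define \<phi> where "\<phi> n i = S' (t - real i * t / real n) u" for n i
  define R where "R n \<omega> = (\<Sum>i<n. W (real (Suc i) * (t / real n)) (\<phi> n i) \<omega>
      - W (real i * (t / real n)) (\<phi> n i) \<omega>)" for n \<omega>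
  have \<phi>: "\<phi> n i \<in> L2 \<mu>" if "i < n" for n i
  proof -
    have "real i * t / real n \<le> t"
      using that t by (simp add: divide_simps mult.commute[of _ t] mult_left_mono)
    then show ?thesis unfolding \<phi>_def by (intro S') simp
  qed
  have step: "square_integrable P (R n)" "expectation (R n) = 0"
    "expectation (\<lambda>\<omega>. (R n \<omega>)\<^sup>2) = t / real n * (\<Sum>i<n. (l2_norm \<mu> (\<phi> n i))\<^sup>2)" for n
    unfolding R_def using Ito_isometry_step[OF W, of "t / real n" n "\<phi> n"] \<phi> t by auto
  have I2: "square_integrable P I"
    using I by (simp add: wiener_integral_def square_integrable_def)
  have lim: "(\<lambda>n. expectation (\<lambda>\<omega>. (I \<omega> - R n \<omega>)\<^sup>2)) \<longlonglongrightarrow> 0"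
    using I by (simp add: wiener_integral_def R_def \<phi>_def)
  note m = mean_square_limit_moments[OF prob_space_axioms I2 step(1) lim]
  have "expectation I = 0"
    using m(1) unfolding step(2) by (simp add: LIMSEQ_const_iff)
  then have "covariance P I I = expectation (\<lambda>\<omega>. (I \<omega>)\<^sup>2)"
    by (simp add: covariance_def power2_eq_square)
  moreover have "(\<Sum>i<n. (l2_norm \<mu> (\<phi> n i))\<^sup>2)
      = (\<Sum>k<n. (l2_norm \<mu> (S' (real (Suc k) * (t / real n)) u))\<^sup>2)" for n
  proof -
    have "(\<Sum>k<n. (l2_norm \<mu> (S' (real (Suc k) * (t / real n)) u))\<^sup>2)
        = (\<Sum>i<n. (l2_norm \<mu> (S' (real (Suc (n - Suc i)) * (t / real n)) u))\<^sup>2)"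
      by (rule sum.nat_diff_reindex[symmetric])
    also have "\<dots> = (\<Sum>i<n. (l2_norm \<mu> (\<phi> n i))\<^sup>2)"
    proof (rule sum.cong[OF refl])
      fix i assume "i \<in> {..<n}"
      then have "real (Suc (n - Suc i)) = real n - real i" "real n \<noteq> 0" by auto
      then have "real (Suc (n - Suc i)) * (t / real n) = t - real i * t / real n"
        by (simp add: field_simps)
      then show "(l2_norm \<mu> (S' (real (Suc (n - Suc i)) * (t / real n)) u))\<^sup>2 = (l2_norm \<mu> (\<phi> n i))\<^sup>2"
        by (simp add: \<phi>_def)
    qed
    finally show ?thesis by simp
  qed
  ultimately show ?thesis using m(2) by (simp add: step(3))
qed

section \<open>A lower bound for the variance of the stochastic convolution\<close>

text \<open>
  Moving $S(s)$ to the other side of the inner product turns the increment of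
  $\langle S(s)u, u\rangle$ into $\langle S(h)u - u, S'(s)u\rangle$. Only the difference quotient at
  time $0$ enters, so its error does not depend on $s$.
\<close>

lemma adjoint_orbit_step:
  assumes gen: "generates_semigroup \<mu> D A S" and u: "u \<in> D"
    and adj: "\<And>s. 0 \<le> s \<Longrightarrow> adjoint_pair \<mu> (S s) (S' s)"
    and s: "0 \<le> s" and h: "0 < h"
  shows "\<bar>l2_inner \<mu> (S (s + h) u) u - l2_inner \<mu> (S s u) u\<bar>
    \<le> h * (l2_norm \<mu> (A u) + l2_norm \<mu> (\<lambda>x. (S h u x - u x) / h - A u x)) * l2_norm \<mu> (S' s u)"
proof -
  have c0: "c0_semigroup \<mu> S" and uL: "u \<in> L2 \<mu>" and AuL: "A u \<in> L2 \<mu>"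
    using gen u by (auto simp: generates_semigroup_def)
  have SL: "S r v \<in> L2 \<mu>" if "0 \<le> r" "v \<in> L2 \<mu>" for r v
    using c0 that by (auto simp: c0_semigroup_def bounded_op_def)
  have adjI: "l2_inner \<mu> (S s v) w = l2_inner \<mu> v (S' s w)" if "v \<in> L2 \<mu>" "w \<in> L2 \<mu>" for v w
    using adj[OF s] that by (auto simp: adjoint_pair_def)
  define w where "w = S' s u"
  define d where "d x = (S h u x - u x) / h - A u x" for x
  have wL: "w \<in> L2 \<mu>"
    using adj[OF s] uL by (auto simp: w_def adjoint_pair_def bounded_op_def)
  have hL: "S h u \<in> L2 \<mu>" using SL h uL by simp
  have dL: "d \<in> L2 \<mu>"
  proof -
    have "square_integrable \<mu> (\<lambda>x. (1 / h) * (S h u x - u x) - A u x)"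
      using hL uL AuL unfolding L2_iff
      by (intro square_integrable_diff square_integrable_cmult)
    then show ?thesis by (simp add: L2_iff d_def[abs_def])
  qed
  have "l2_inner \<mu> (S (s + h) u) u = l2_inner \<mu> (S s (S h u)) u"
    using c0 s h uL SL hL by (intro l2_inner_cong_AE) (auto simp: c0_semigroup_def)
  also have "\<dots> = l2_inner \<mu> (S h u) w"
    using adjI[OF hL uL] by (simp add: w_def)
  finally have "l2_inner \<mu> (S (s + h) u) u - l2_inner \<mu> (S s u) u
      = 1 * l2_inner \<mu> (S h u) w + (- 1) * l2_inner \<mu> u w"
    using adjI[OF uL uL] by (simp add: w_def)
  also have "\<dots> = l2_inner \<mu> (\<lambda>x. 1 * S h u x + (- 1) * u x) w"
    by (rule l2_inner_add[symmetric]) fact+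
  also have "(\<lambda>x. 1 * S h u x + (- 1) * u x) = (\<lambda>x. h * A u x + h * d x)"
    using h by (auto simp: d_def field_simps)
  also have "l2_inner \<mu> (\<lambda>x. h * A u x + h * d x) w = h * (l2_inner \<mu> (A u) w + l2_inner \<mu> d w)"
    by (simp add: l2_inner_add[OF AuL dL wL] distrib_left)
  finally have "\<bar>l2_inner \<mu> (S (s + h) u) u - l2_inner \<mu> (S s u) u\<bar>
      = h * \<bar>l2_inner \<mu> (A u) w + l2_inner \<mu> d w\<bar>"
    using h by (simp add: abs_mult)
  also have "\<dots> \<le> h * (l2_norm \<mu> (A u) * l2_norm \<mu> w + l2_norm \<mu> d * l2_norm \<mu> w)"
    using l2_Cauchy_Schwarz[OF AuL wL] l2_Cauchy_Schwarz[OF dL wL] h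
    by (intro mult_left_mono) auto
  finally show ?thesis
    by (simp add: w_def d_def[abs_def] algebra_simps)
qed

text \<open>
  The discrete form of $1 - a\sqrt{t\,Q_t} \le \sqrt{Q_t/t}$: here $q$ is the Riemann sum for $Q_t$
  with step $h$, and $a$ is enlarged by the error of the difference quotient. The extra $h$ inside
  the root accounts for passing from left-endpoint sums, which the telescoping of
  $\langle S(kh)u, u\rangle$ produces, to the right-endpoint sum $q$.
\<close>

lemma adjoint_orbit_Riemann_bound:
  fixes n :: nat
  assumes gen: "generates_semigroup \<mu> D A S" and u: "u \<in> D" and u1: "l2_norm \<mu> u = 1"
    and adj: "\<And>s. 0 \<le> s \<Longrightarrow> adjoint_pair \<mu> (S s) (S' s)"
    and t: "0 < t" and n: "0 < n"
  defines "h \<equiv> t / real n"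
  defines "q \<equiv> h * (\<Sum>k<n. (l2_norm \<mu> (S' (real (Suc k) * h) u))\<^sup>2)"
  shows "1 - (l2_norm \<mu> (A u) + l2_norm \<mu> (\<lambda>x. (S h u x - u x) / h - A u x)) * sqrt (t * (h + q))
    \<le> sqrt (q / t)"
proof -
  have h: "0 < h" and hn: "h * real n = t" using t n by (auto simp: h_def)
  have c0: "c0_semigroup \<mu> S" and uL: "u \<in> L2 \<mu>"
    using gen u by (auto simp: generates_semigroup_def)
  define c where "c = l2_norm \<mu> (A u) + l2_norm \<mu> (\<lambda>x. (S h u x - u x) / h - A u x)"
  have c: "0 \<le> c" by (simp add: c_def l2_norm_nonneg)
  define y where "y k = l2_norm \<mu> (S' (real k * h) u)" for k
  define \<phi> where "\<phi> k = l2_inner \<mu> (S (real k * h) u) u" for k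
  have y: "0 \<le> y k" for k by (simp add: y_def l2_norm_nonneg)
  have S'L: "S' s u \<in> L2 \<mu>" if "0 \<le> s" for s
    using adj[OF that] uL by (auto simp: adjoint_pair_def bounded_op_def)
  have \<phi>_le: "\<phi> k \<le> y k" for k
  proof -
    have "0 \<le> real k * h" using h by simp
    then have "\<phi> k = l2_inner \<mu> u (S' (real k * h) u)"
      using adj[of "real k * h"] uL by (simp add: \<phi>_def adjoint_pair_def)
    then show ?thesis
      using l2_Cauchy_Schwarz[OF uL S'L[OF \<open>0 \<le> real k * h\<close>]] u1 by (simp add: y_def)
  qed
  have S0: "l2_inner \<mu> (S 0 v) u = l2_inner \<mu> v u" if "v \<in> L2 \<mu>" for v
    using c0 that uL by (intro l2_inner_cong_AE) (auto simp: c0_semigroup_def bounded_op_def)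
  have \<phi>0: "\<phi> 0 = 1"
    using S0[OF uL] u1 by (simp add: \<phi>_def l2_inner_self)
  \<comment> \<open>\<open>y 0\<close> is the one left-endpoint value that does not occur in \<open>q\<close>.\<close>
  have y0: "y 0 \<le> 1"
  proof -
    have "(y 0)\<^sup>2 = l2_inner \<mu> (S' 0 u) (S' 0 u)" by (simp add: y_def l2_inner_self)
    also have "\<dots> = l2_inner \<mu> (S 0 (S' 0 u)) u"
      using adj[of 0] uL S'L[of 0] by (simp add: adjoint_pair_def)
    also have "\<dots> \<le> y 0"
      using S0[OF S'L[of 0]] l2_Cauchy_Schwarz[OF S'L[of 0] uL] u1 by (simp add: y_def)
    finally show ?thesis using y[of 0]
      by (cases "y 0 = 0") (auto simp: power2_eq_square)
  qed
  have \<phi>_ge: "1 - c * (h * (\<Sum>k<m. y k)) \<le> \<phi> m" for m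
  proof (induction m)
    case 0 then show ?case by (simp add: \<phi>0)
  next
    case (Suc m)
    have "\<bar>\<phi> (Suc m) - \<phi> m\<bar> \<le> h * c * y m"
      using adjoint_orbit_step[OF gen u adj _ h, of "real m * h"] h
      by (simp add: \<phi>_def c_def y_def algebra_simps)
    then show ?case using Suc by (simp add: algebra_simps)
  qed
  have q: "q = h * (\<Sum>k<n. (y (Suc k))\<^sup>2)" by (simp add: q_def y_def)
  have q0: "0 \<le> q" using h by (simp add: q sum_nonneg)
  have sum_y: "h * (\<Sum>k<m. y k) \<le> sqrt (t * (h + q))" if "m \<le> n" for m
  proof (rule real_le_rsqrt)
    have sq: "(\<Sum>k<n. (y k)\<^sup>2) \<le> 1 + (\<Sum>k<n. (y (Suc k))\<^sup>2)"
    proof -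
      have "(\<Sum>k<n. (y k)\<^sup>2) \<le> (\<Sum>k<Suc n. (y k)\<^sup>2)" by simp
      also have "\<dots> = (y 0)\<^sup>2 + (\<Sum>k<n. (y (Suc k))\<^sup>2)" by (rule sum.lessThan_Suc_shift)
      finally show ?thesis using y0 y[of 0] power_le_one[of "y 0" 2] by simp
    qed
    have "(\<Sum>k<m. y k) \<le> (\<Sum>k<n. y k)"
      using that y by (intro sum_mono2) auto
    then have "(h * (\<Sum>k<m. y k))\<^sup>2 \<le> (h * (\<Sum>k<n. y k))\<^sup>2"
      using h y by (intro power_mono mult_left_mono mult_nonneg_nonneg sum_nonneg) auto
    also have "\<dots> \<le> h\<^sup>2 * ((\<Sum>k<n. (y k)\<^sup>2) * real n)"
      using sum_squared_le_sum_of_squares[of y "{..<n}"]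
      by (simp add: power_mult_distrib mult_left_mono)
    also have "\<dots> = t * (h * (\<Sum>k<n. (y k)\<^sup>2))"
      by (simp add: hn[symmetric] power2_eq_square mult_ac)
    also have "\<dots> \<le> t * (h * (1 + (\<Sum>k<n. (y (Suc k))\<^sup>2)))"
      using sq t h by (intro mult_left_mono) auto
    finally show "(h * (\<Sum>k<m. y k))\<^sup>2 \<le> t * (h + q)" by (simp add: q distrib_left)
  qed
  define L where "L = 1 - c * sqrt (t * (h + q))"
  have L_le: "L \<le> y m" if "m \<le> n" for m
  proof -
    have "L \<le> 1 - c * (h * (\<Sum>k<m. y k))"
      unfolding L_def using mult_left_mono[OF sum_y[OF that] c] by simp
    then show ?thesis using \<phi>_ge[of m] \<phi>_le[of m] by simp
  qed
  have "L \<le> sqrt (q / t)"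
  proof (cases "0 \<le> L")
    case True
    have "t * L\<^sup>2 = h * (\<Sum>k<n. L\<^sup>2)" by (simp add: hn[symmetric])
    also have "\<dots> \<le> q"
      unfolding q using h True L_le by (intro mult_left_mono sum_mono power_mono) auto
    finally have "L\<^sup>2 \<le> q / t" using t by (simp add: field_simps)
    then show ?thesis by (rule real_le_rsqrt)
  next
    case False
    moreover have "0 \<le> sqrt (q / t)" using q0 t by simp
    ultimately show ?thesis by linarith
  qed
  then show ?thesis by (simp add: L_def c_def)
qed

text \<open>
  The time $1/a$ balances the two sides of $1 \le a\sqrt{t\,Q} + \sqrt{Q/t}$: both terms on the
  right become $\sqrt{aQ}$.
\<close>

lemma adjoint_orbit_integral_bound:
  assumes gen: "generates_semigroup \<mu> D A S" and u: "u \<in> D" and u1: "l2_norm \<mu> u = 1"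
    and adj: "\<And>s. 0 \<le> s \<Longrightarrow> adjoint_pair \<mu> (S s) (S' s)"
    and a: "0 < a" "l2_norm \<mu> (A u) \<le> a"
    and lim: "(\<lambda>n. (1 / a) / real n * (\<Sum>k<n. (l2_norm \<mu> (S' (real (Suc k) * ((1 / a) / real n)) u))\<^sup>2))
      \<longlonglongrightarrow> Q"
  shows "1 / (4 * a) \<le> Q"
proof -
  define t where "t = 1 / a"
  have t: "0 < t" using a by (simp add: t_def)
  define q where "q n = t / real n * (\<Sum>k<n. (l2_norm \<mu> (S' (real (Suc k) * (t / real n)) u))\<^sup>2)" for n
  define d where "d h = l2_norm \<mu> (\<lambda>x. (S h u x - u x) / h - A u x)" for h
  have q: "q \<longlonglongrightarrow> Q" using lim by (simp add: q_def[abs_def] t_def)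
  have q0: "0 \<le> q n" for n using t by (simp add: q_def sum_nonneg)
  then have Q0: "0 \<le> Q" using q by (intro LIMSEQ_le_const) auto
  have h: "(\<lambda>n. t / real n) \<longlonglongrightarrow> 0" by (rule lim_const_over_n)
  have "(d \<longlongrightarrow> 0) (at_right 0)"
    using gen u by (auto simp: generates_semigroup_def right_derivative_at_0_def d_def[abs_def])
  moreover have "filterlim (\<lambda>n. t / real n) (at_right 0) sequentially"
    unfolding filterlim_at using h t
    by (auto intro!: exI[of _ 1] simp: eventually_sequentially)
  ultimately have d: "(\<lambda>n. d (t / real n)) \<longlonglongrightarrow> 0" by (rule filterlim_compose)
  have "1 - (a + 0) * sqrt (t * (0 + Q)) \<le> sqrt (Q / t)"
  proof (rule tendsto_le)
    show "(\<lambda>n. 1 - (a + d (t / real n)) * sqrt (t * (t / real n + q n)))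
        \<longlonglongrightarrow> 1 - (a + 0) * sqrt (t * (0 + Q))"
      by (intro tendsto_intros d h q)
    show "(\<lambda>n. sqrt (q n / t)) \<longlonglongrightarrow> sqrt (Q / t)"
      using t by (intro tendsto_intros q) auto
    show "\<forall>\<^sub>F n in sequentially. 1 - (a + d (t / real n)) * sqrt (t * (t / real n + q n)) \<le> sqrt (q n / t)"
      using eventually_gt_at_top[of 0]
    proof eventually_elim
      case (elim n)
      have "0 \<le> sqrt (t * (t / real n + q n))" using t q0[of n] by simp
      then have "(l2_norm \<mu> (A u) + d (t / real n)) * sqrt (t * (t / real n + q n))
          \<le> (a + d (t / real n)) * sqrt (t * (t / real n + q n))"
        using a by (intro mult_right_mono) auto
      with adjoint_orbit_Riemann_bound[OF gen u u1 adj t elim] show ?case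
        by (simp add: q_def d_def)
    qed
  qed simp
  moreover have "a * sqrt (t * Q) = sqrt (a * Q)" "sqrt (Q / t) = sqrt (a * Q)"
    using a by (auto simp: t_def real_sqrt_mult real_sqrt_divide field_simps)
  ultimately have "1 \<le> 2 * sqrt (a * Q)" by simp
  then have "(1 / 2)\<^sup>2 \<le> (sqrt (a * Q))\<^sup>2" by (intro power_mono) auto
  then have "1 / 4 \<le> a * Q" using a Q0 by (simp add: power2_eq_square)
  then show ?thesis using a by (simp add: field_simps)
qed

text \<open>
  For a general pair of times the Riemann sums use unrelated grids, and \<open>y\<close> need not be Riemann
  integrable, so the limits cannot be compared directly. The grid of $[0,2t]$ with $2m$
  cells, however, extends that of $[0,t]$ with $m$ cells, and monotonicity along $t, 2t, 4t, \dots$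
  is enough to compare with the limit at infinity.
\<close>

lemma Riemann_limit_double:
  fixes y :: "real \<Rightarrow> real"
  assumes y: "\<And>s. 0 \<le> y s" and t: "0 \<le> t"
    and lim: "\<And>t. 0 \<le> t \<Longrightarrow>
      (\<lambda>n. t / real n * (\<Sum>k<n. y (real (Suc k) * (t / real n)))) \<longlonglongrightarrow> Q t"
  shows "Q t \<le> Q (2 * t)"
proof -
  define R where "R r n = r / real n * (\<Sum>k<n. y (real (Suc k) * (r / real n)))" for r n
  have "R t m \<le> R (2 * t) (2 * m)" for m
  proof -
    have "2 * t / real (2 * m) = t / real m" by simp
    then have "R (2 * t) (2 * m) = t / real m * (\<Sum>k<2 * m. y (real (Suc k) * (t / real m)))"
      unfolding R_def by (simp only:)
    moreover have "(\<Sum>k<m. y (real (Suc k) * (t / real m))) \<le> (\<Sum>k<2 * m. y (real (Suc k) * (t / real m)))"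
      using y by (intro sum_mono2) auto
    ultimately show ?thesis
      unfolding R_def using t by (simp only:) (intro mult_left_mono, auto)
  qed
  moreover have "R t \<longlonglongrightarrow> Q t" using lim[OF t] by (simp add: R_def[abs_def])
  moreover have "(\<lambda>m. R (2 * t) (2 * m)) \<longlonglongrightarrow> Q (2 * t)"
  proof (rule filterlim_compose[of "R (2 * t)"])
    show "R (2 * t) \<longlonglongrightarrow> Q (2 * t)" using lim[of "2 * t"] t by (simp add: R_def[abs_def])
    show "filterlim (\<lambda>m::nat. 2 * m) at_top sequentially"
      by (rule filterlim_subseq) (auto intro: strict_monoI)
  qed
  ultimately show ?thesis by (intro LIMSEQ_le) auto
qed

lemma le_limit_of_doubling:
  fixes Q :: "real \<Rightarrow> real"
  assumes mono: "\<And>t. 0 \<le> t \<Longrightarrow> Q t \<le> Q (2 * t)" and lim: "(Q \<longlongrightarrow> v) at_top" and t: "0 < t"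
  shows "Q t \<le> v"
proof (rule LIMSEQ_le_const)
  have "filterlim (\<lambda>j::nat. 2 ^ j * t) at_top sequentially"
  proof (rule filterlim_at_top_mono)
    show "filterlim (\<lambda>j::nat. real j * t) at_top sequentially"
      using filterlim_at_top_mult_tendsto_pos[OF tendsto_const t filterlim_real_sequentially] .
    show "\<forall>\<^sub>F j in sequentially. real j * t \<le> 2 ^ j * t"
      using t by (intro always_eventually allI mult_right_mono) (auto intro: less_imp_le)
  qed
  then show "(\<lambda>j::nat. Q (2 ^ j * t)) \<longlonglongrightarrow> v"
    using lim by (rule filterlim_compose[rotated])
  have "Q t \<le> Q (2 ^ j * t)" for j :: nat
  proof (induction j)
    case (Suc j)
    also have "Q (2 ^ j * t) \<le> Q (2 * (2 ^ j * t))" using t by (intro mono) simp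
    finally show ?case by (simp add: mult.assoc)
  qed simp
  then show "\<exists>N. \<forall>j\<ge>N. Q t \<le> Q (2 ^ j * t)" by blast
qed

lemma asymptotic_covariance_op_norm_ge:
  assumes W: "cylindrical_wiener P \<mu> W"
    and gen: "generates_semigroup \<mu> D A S"
    and Z: "stochastic_convolution P \<mu> W S Z"
    and V: "asymptotic_covariance_op P \<mu> Z V"
    and u: "u \<in> D" "l2_norm \<mu> u = 1" and a: "0 < a" "l2_norm \<mu> (A u) \<le> a"
  shows "ereal (1 / (4 * a)) \<le> op_norm \<mu> V"
proof -
  have uL: "u \<in> L2 \<mu>" using gen u by (auto simp: generates_semigroup_def)
  obtain S' where adj: "\<And>t. 0 \<le> t \<Longrightarrow> adjoint_pair \<mu> (S t) (S' t)"
    and wi: "\<And>t. 0 \<le> t \<Longrightarrow> wiener_integral P W t (\<lambda>s. S' (t - s) u) (Z t u)"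
    using Z uL unfolding stochastic_convolution_def by blast
  have S'L: "S' s u \<in> L2 \<mu>" if "0 \<le> s" for s
    using adj[OF that] uL by (auto simp: adjoint_pair_def bounded_op_def)
  define Q where "Q t = covariance P (Z t u) (Z t u)" for t
  have Q: "(\<lambda>n. t / real n * (\<Sum>k<n. (l2_norm \<mu> (S' (real (Suc k) * (t / real n)) u))\<^sup>2)) \<longlonglongrightarrow> Q t"
    if "0 \<le> t" for t
    unfolding Q_def
    by (rule stochastic_convolution_variance[where S' = S' and u = u, OF W wi[OF that] S'L that])
  have "1 / (4 * a) \<le> Q (1 / a)"
  proof (rule adjoint_orbit_integral_bound[where S' = S' and u = u, OF gen u adj a])
    show "(\<lambda>n. 1 / a / real n * (\<Sum>k<n. (l2_norm \<mu> (S' (real (Suc k) * (1 / a / real n)) u))\<^sup>2))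
        \<longlonglongrightarrow> Q (1 / a)"
      by (rule Q) (use a in simp)
  qed
  also have "\<dots> \<le> l2_inner \<mu> (V u) u"
  proof (rule le_limit_of_doubling[where Q = Q])
    show "Q t \<le> Q (2 * t)" if "0 \<le> t" for t
      using Riemann_limit_double[of "\<lambda>s. (l2_norm \<mu> (S' s u))\<^sup>2" t Q] that Q by simp
    show "(Q \<longlongrightarrow> l2_inner \<mu> (V u) u) at_top"
      using V uL by (simp add: asymptotic_covariance_op_def Q_def[abs_def])
  qed (use a in simp)
  also have "\<dots> \<le> l2_norm \<mu> (V u)"
    using l2_Cauchy_Schwarz[of "V u" \<mu> u] V uL u(2)
    by (simp add: asymptotic_covariance_op_def bounded_op_def)
  finally have "ereal (1 / (4 * a)) \<le> ereal (l2_norm \<mu> (V u))" by simp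
  also have "\<dots> \<le> op_norm \<mu> V"
    unfolding op_norm_def using uL u(2) by (intro SUP_upper) auto
  finally show ?thesis .
qed

section \<open>Approximate eigenfunctions at the top of the essential range\<close>

lemma L2_of_AE_bound:
  assumes u: "u \<in> L2 \<mu>" and g: "g \<in> borel_measurable \<mu>" and C: "0 \<le> C"
    and bound: "AE x in \<mu>. \<bar>g x\<bar> \<le> C * \<bar>u x\<bar>"
  shows "g \<in> L2 \<mu>" "l2_norm \<mu> g \<le> C * l2_norm \<mu> u"
proof -
  have sq: "AE x in \<mu>. (g x)\<^sup>2 \<le> C\<^sup>2 * (u x)\<^sup>2"
    using bound
  proof eventually_elim
    case (elim x)
    then have "\<bar>g x\<bar>\<^sup>2 \<le> (C * \<bar>u x\<bar>)\<^sup>2" by (intro power_mono) auto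
    then show ?case by (simp add: power_mult_distrib)
  qed
  have iu: "integrable \<mu> (\<lambda>x. C\<^sup>2 * (u x)\<^sup>2)" using u by (simp add: L2_def)
  have ig: "integrable \<mu> (\<lambda>x. (g x)\<^sup>2)"
    using iu by (rule Bochner_Integration.integrable_bound) (use g sq in auto)
  then show "g \<in> L2 \<mu>" using g by (simp add: L2_def)
  have "sqrt (LINT x|\<mu>. (g x)\<^sup>2) \<le> sqrt (LINT x|\<mu>. C\<^sup>2 * (u x)\<^sup>2)"
    using integral_mono_AE[OF ig iu sq] by simp
  then show "l2_norm \<mu> g \<le> C * l2_norm \<mu> u"
    using C by (simp add: l2_norm_eq real_sqrt_mult)
qed

text \<open>
  The normalised indicator of a set of finite positive measure on which $f$ is within $\epsilon$ of
  its essential supremum: $\sigma$-finiteness provides a subset of finite measure, and on it $f$ is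
  bounded, so that $u$ lies in the domain although $f$ may be unbounded below.
\<close>

lemma approximate_eigenfunction:
  assumes sf: "sigma_finite_measure \<mu>" and f: "f \<in> borel_measurable \<mu>"
    and M: "esssup \<mu> (\<lambda>x. ereal (f x)) = ereal M" and \<epsilon>: "0 < \<epsilon>" and p: "p < - M"
  obtains u where "u \<in> mult_dom \<mu> f" "l2_norm \<mu> u = 1"
    "l2_norm \<mu> (shift_op p (mult_op f) u) \<le> - p - M + \<epsilon>"
proof -
  interpret sigma_finite_measure \<mu> by fact
  note f[measurable]
  define B where "B = {x \<in> space \<mu>. f x > M - \<epsilon>}"
  have [measurable]: "B \<in> sets \<mu>" by (simp add: B_def)
  have "0 < emeasure \<mu> B"
    using esssup_pos_measure[of "\<lambda>x. ereal (f x)" \<mu> "ereal (M - \<epsilon>)"] M \<epsilon> by (simp add: B_def)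
  then obtain A where A: "A \<in> sets \<mu>" "A \<subseteq> B" "emeasure \<mu> A < \<infinity>" "0 < emeasure \<mu> A"
  proof (cases "emeasure \<mu> B = \<infinity>")
    case True
    then show ?thesis
      using approx_PInf_emeasure_with_finite[of B 0] that by auto
  next
    case False
    then show ?thesis using that[of B] \<open>0 < emeasure \<mu> B\<close>
      by (simp add: less_top)
  qed
  note A(1)[measurable]
  define m where "m = measure \<mu> A"
  have m: "0 < m" using A by (simp add: m_def measure_def enn2real_positive_iff)
  define u where "u x = indicator A x / sqrt m" for x :: real
  have um[measurable]: "u \<in> borel_measurable \<mu>" unfolding u_def by measurable
  have u2: "(u x)\<^sup>2 = indicator A x / m" for x
    using m by (auto simp: u_def power_divide indicator_def)
  have int: "integrable \<mu> (indicator A :: real \<Rightarrow> real)" using A by simp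
  have uL: "u \<in> L2 \<mu>" using int um by (simp add: L2_def u2)
  have u1: "l2_norm \<mu> u = 1"
    using m A(1) sets.sets_into_space[OF A(1)]
    by (simp add: l2_norm_eq u2 m_def Int_absorb2)
  have "AE x in \<mu>. f x \<le> M" using esssup_AE[of "\<lambda>x. ereal (f x)" \<mu>] M by simp
  then have range: "AE x in \<mu>. u x \<noteq> 0 \<longrightarrow> M - \<epsilon> < f x \<and> f x \<le> M"
    by eventually_elim (use A(2) in \<open>auto simp: u_def B_def indicator_def split: if_splits\<close>)
  have "AE x in \<mu>. \<bar>mult_op f u x\<bar> \<le> (\<bar>M\<bar> + \<epsilon>) * \<bar>u x\<bar>"
    using range
  proof eventually_elim
    case (elim x)
    show ?case
    proof (cases "u x = 0")
      case False
      then have "\<bar>f x\<bar> \<le> \<bar>M\<bar> + \<epsilon>" using elim by auto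
      then show ?thesis by (simp add: mult_op_def abs_mult mult_right_mono)
    qed (simp add: mult_op_def)
  qed
  then have "mult_op f u \<in> L2 \<mu>"
    by (rule L2_of_AE_bound(1)[OF uL, rotated 2]) (use \<epsilon> in \<open>auto simp: mult_op_def\<close>)
  then have D: "u \<in> mult_dom \<mu> f" using uL by (simp add: mult_dom_def)
  have "AE x in \<mu>. \<bar>shift_op p (mult_op f) u x\<bar> \<le> (- p - M + \<epsilon>) * \<bar>u x\<bar>"
    using range
  proof eventually_elim
    case (elim x)
    have e: "shift_op p (mult_op f) u x = (p + f x) * u x"
      by (simp add: shift_op_def mult_op_def distrib_right)
    show ?case
    proof (cases "u x = 0")
      case False
      then have "\<bar>p + f x\<bar> \<le> - p - M + \<epsilon>" using elim p by auto
      then show ?thesis unfolding e by (simp add: abs_mult mult_right_mono)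
    qed (simp add: e)
  qed
  then have "l2_norm \<mu> (shift_op p (mult_op f) u) \<le> (- p - M + \<epsilon>) * l2_norm \<mu> u"
    by (rule L2_of_AE_bound(2)[OF uL, rotated 2])
      (use \<epsilon> p in \<open>auto simp: shift_op_def[abs_def] mult_op_def[abs_def]\<close>)
  with D u1 that show ?thesis by simp
qed

section \<open>Blow-up at the instability threshold\<close>

theorem theorem4p4:
  fixes \<mu> :: "real measure"
    and f :: "real \<Rightarrow> real"
    and M :: real
    and P :: "'w measure"
    and W :: "real \<Rightarrow> (real \<Rightarrow> real) \<Rightarrow> 'w \<Rightarrow> real"
    and S :: "real \<Rightarrow> real \<Rightarrow> (real \<Rightarrow> real) \<Rightarrow> (real \<Rightarrow> real)"
    and Z :: "real \<Rightarrow> real \<Rightarrow> (real \<Rightarrow> real) \<Rightarrow> 'w \<Rightarrow> real"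
    and V :: "real \<Rightarrow> (real \<Rightarrow> real) \<Rightarrow> (real \<Rightarrow> real)"
  assumes "sigma_finite_measure \<mu>" and "sets \<mu> = sets borel"
    and "f \<in> borel_measurable \<mu>"
    and "esssup \<mu> (\<lambda>x. ereal (f x)) = ereal M"
    and "\<And>x. f x = M \<Longrightarrow> \<exists>N. open N \<and> x \<in> N \<and> continuous_on N f"
    and "cylindrical_wiener P \<mu> W"
    and "\<And>p. p < - M \<Longrightarrow> generates_semigroup \<mu> (mult_dom \<mu> f) (shift_op p (mult_op f)) (S p)"
    and "\<And>p. p < - M \<Longrightarrow> stochastic_convolution P \<mu> W (S p) (Z p)"
    and "\<And>p. p < - M \<Longrightarrow> asymptotic_covariance_op P \<mu> (Z p) (V p)"
  shows "((\<lambda>p. op_norm \<mu> (V p)) \<longlongrightarrow> \<infinity>) (at_left (- M))"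
proof -
  have bound: "ereal (1 / (8 * (- M - p))) \<le> op_norm \<mu> (V p)" if p: "p < - M" for p
  proof -
    \<comment> \<open>Taking \<open>\<epsilon>\<close> equal to the distance of \<open>p\<close> from the threshold costs only a factor 2.\<close>
    obtain u where u: "u \<in> mult_dom \<mu> f" "l2_norm \<mu> u = 1"
      "l2_norm \<mu> (shift_op p (mult_op f) u) \<le> - p - M + (- M - p)"
      using approximate_eigenfunction[OF assms(1,3,4), of "- M - p" p] p by auto
    have "ereal (1 / (4 * (2 * (- M - p)))) \<le> op_norm \<mu> (V p)"
      by (rule asymptotic_covariance_op_norm_ge[OF assms(6) assms(7-9)[OF p] u(1,2)])
        (use p u(3) in auto)
    then show ?thesis by simp
  qed
  show ?thesis unfolding tendsto_PInfty
  proof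
    fix r :: real
    define \<delta> where "\<delta> = 1 / (8 * (\<bar>r\<bar> + 1))"
    have \<delta>: "0 < \<delta>" by (simp add: \<delta>_def)
    have "ereal r < op_norm \<mu> (V p)" if "- M - \<delta> < p" "p < - M" for p
    proof -
      have "8 * (- M - p) < 8 * \<delta>" using that by simp
      also have "8 * \<delta> = 1 / (\<bar>r\<bar> + 1)" by (simp add: \<delta>_def divide_simps)
      finally have "8 * (- M - p) < 1 / (\<bar>r\<bar> + 1)" .
      then have "\<bar>r\<bar> + 1 < 1 / (8 * (- M - p))" using that by (simp add: field_simps)
      then have "ereal r < ereal (1 / (8 * (- M - p)))" by simp
      then show ?thesis using bound[OF that(2)] by (rule less_le_trans)
    qed
    then show "\<forall>\<^sub>F p in at_left (- M). ereal r < op_norm \<mu> (V p)"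
      unfolding eventually_at_left_field using \<delta>
      by (intro exI[of _ "- M - \<delta>"]) auto
  qed
qed

end
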